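(* If $\Phi_1$ and $\Phi_2$ are $N$-functions and $\Phi_2\in\Delta_2$, then $\overline H^1_{\Phi_1,\Phi_2}(\mathbb{R})=0$.
   Context: An $N$-function is a function $\Phi:\mathbb{R}\to[0,\infty)$ that is even and convex, with $\Phi(x)=0\iff x=0$, $\lim_{x\to0}\Phi(x)/x=0$ and $\lim_{x\to\infty}\Phi(x)/x=\infty$. $\Phi\in\Delta_2$ means there is a constant $K>2$ with $\Phi(2x)\le K\Phi(x)$ for all $x\ge0$. For a Riemannian manifold $X$ of dimension $n$ (here $X=\mathbb{R}$ with the standard metric, $n=1$) with volume element $d\mu_X$, and a measurable $k$-form $\omega$ with pointwise norm $|\omega(x)|$, put $\rho_\Phi(\omega)=\int_X\Phi(|\omega(x)|)\,d\mu_X$. Forms differing on a set of measure zero are identified. $L^\Phi(X,\Lambda^k)$ is the space of measurable $k$-forms $\omega$ with $\rho_\Phi(\alpha\omega)<\infty$ for some $\alpha>0$, endowed with the gauge norm $\|\omega\|_{(\Phi)}=\inf\{K>0:\rho_\Phi(\omega/K)\le1\}$; it is a Banach space. Weak differential: a locally integrable $(j+1)$-form $\theta$ is the (weak) differential $d\omega$ of a locally integrable $j$-form $\omega$ if $\int_U\omega\wedge du=(-1)^{j+1}\int_U\theta\wedge u$ for every orientable domain $U\subset\mathrm{Int}\,X$ and every smooth compactly supported $(n-j-1)$-form $u$ with support in $U$. $Z^k_{\Phi_2}(X)=\{\omega\in L^{\Phi_2}(X,\Lambda^k): d\omega=0\}$; $B^k_{\Phi_1,\Phi_2}(X)=\{\omega\in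 L^{\Phi_2}(X,\Lambda^k):\omega=d\beta\text{ for some }\beta\in L^{\Phi_1}(X,\Lambda^{k-1})\}$; $\overline B^k_{\Phi_1,\Phi_2}(X)$ is the closure of $B^k_{\Phi_1,\Phi_2}(X)$ in $L^{\Phi_2}(X,\Lambda^k)$. The reduced $L_{\Phi_1,\Phi_2}$-cohomology is $\overline H^k_{\Phi_1,\Phi_2}(X)=Z^k_{\Phi_2}(X)/\overline B^k_{\Phi_1,\Phi_2}(X)$. *)

theory Defs
  imports "HOL-Analysis.Analysis"
begin

section \<open>N-functions\<close>

definition N_function :: "(real \<Rightarrow> real) \<Rightarrow> bool" where
  "N_function \<Phi> \<longleftrightarrow>
     (\<forall>x. 0 \<le> \<Phi> x) \<and> (\<forall>x. \<Phi> (- x) = \<Phi> x) \<and> convex_on UNIV \<Phi> \<and>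
     (\<forall>x. \<Phi> x = 0 \<longleftrightarrow> x = 0) \<and>
     ((\<lambda>x. \<Phi> x / x) \<longlongrightarrow> 0) (at 0) \<and>
     filterlim (\<lambda>x. \<Phi> x / x) at_top at_top"

definition Delta2 :: "(real \<Rightarrow> real) \<Rightarrow> bool" where
  "Delta2 \<Phi> \<longleftrightarrow> (\<exists>K>2. \<forall>x\<ge>0. \<Phi> (2 * x) \<le> K * \<Phi> x)"

section \<open>Differential forms on the real line\<close>

text \<open>
  The exterior algebra of the cotangent space of the line at a point has the orthonormal basis
  1, dx. The pair (a, b) stands for a + b dx, and the norm of the product type
  is the norm induced by the standard metric. Degrees are integers, so that the degree
  n - j - 1 of the test forms below makes sense for all j; the only form
  of a degree other than 0 and 1 is the zero form.
\<close>

type_synonym form = "real \<Rightarrow> real \<times> real"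

definition form_of_degree :: "int \<Rightarrow> form \<Rightarrow> bool" where
  "form_of_degree k \<omega> \<longleftrightarrow>
     (\<forall>x. (k \<noteq> 0 \<longrightarrow> fst (\<omega> x) = 0) \<and> (k \<noteq> 1 \<longrightarrow> snd (\<omega> x) = 0))"

text \<open>The product (a + b dx) (c + d dx), using that dx squares to 0.\<close>

definition wedge :: "form \<Rightarrow> form \<Rightarrow> form" where
  "wedge \<omega> \<eta> = (\<lambda>x. (fst (\<omega> x) * fst (\<eta> x),
                     fst (\<omega> x) * snd (\<eta> x) + snd (\<omega> x) * fst (\<eta> x)))"

definition smooth_form :: "form \<Rightarrow> bool" where
  "smooth_form u \<longleftrightarrow>
     (\<forall>m. (deriv ^^ m) (\<lambda>x. fst (u x)) differentiable_on UNIV \<and>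
          (deriv ^^ m) (\<lambda>x. snd (u x)) differentiable_on UNIV)"

definition ext_deriv :: "form \<Rightarrow> form" where
  "ext_deriv u = (\<lambda>x. (0, deriv (\<lambda>t. fst (u t)) x))"

definition form_integral :: "real set \<Rightarrow> form \<Rightarrow> real" where
  "form_integral U \<omega> = (LINT x:U|lebesgue. snd (\<omega> x))"

definition locally_integrable_form :: "form \<Rightarrow> bool" where
  "locally_integrable_form \<omega> \<longleftrightarrow> (\<forall>C. compact C \<longrightarrow> set_integrable lebesgue C \<omega>)"

definition test_form :: "real set \<Rightarrow> int \<Rightarrow> form \<Rightarrow> bool" where
  "test_form U k u \<longleftrightarrow>
     form_of_degree k u \<and> smooth_form u \<and>
     compact (closure {x. u x \<noteq> 0}) \<and> closure {x. u x \<noteq> 0} \<subseteq> U"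

text \<open>
  \<open>weak_differential j \<omega> \<theta>\<close>: the \<open>(j + 1)\<close>-form \<open>\<theta>\<close> is the weak differential of the \<open>j\<close>-form
  \<open>\<omega>\<close>. The test forms have degree \<open>n - j - 1\<close> with \<open>n = 1\<close>. Every domain of the line is
  orientable; it carries the standard orientation, and reversing it would change the sign of both
  sides.
\<close>

definition weak_differential :: "int \<Rightarrow> form \<Rightarrow> form \<Rightarrow> bool" where
  "weak_differential j \<omega> \<theta> \<longleftrightarrow>
     form_of_degree j \<omega> \<and> locally_integrable_form \<omega> \<and>
     form_of_degree (j + 1) \<theta> \<and> locally_integrable_form \<theta> \<and>
     (\<forall>U u. open U \<and> connected U \<and> U \<noteq> {} \<and> test_form U (1 - j - 1) u \<longrightarrow>
        form_integral U (wedge \<omega> (ext_deriv u)) =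
        (-1) powi (j + 1) * form_integral U (wedge \<theta> u))"

section \<open>Orlicz spaces of forms\<close>

definition modular :: "(real \<Rightarrow> real) \<Rightarrow> form \<Rightarrow> ennreal" where
  "modular \<Phi> \<omega> = (\<integral>\<^sup>+x. ennreal (\<Phi> (norm (\<omega> x))) \<partial>lebesgue)"

text \<open>
  The elements of the spaces below are forms, not classes of forms modulo equality almost
  everywhere, so the gauge norm is a seminorm on them. Forms that are equal almost everywhere
  have gauge distance 0, hence are identified in the quotient by a closed subspace.
\<close>

definition orlicz_forms :: "(real \<Rightarrow> real) \<Rightarrow> int \<Rightarrow> form set" where
  "orlicz_forms \<Phi> k =
     {\<omega>. form_of_degree k \<omega> \<and> \<omega> \<in> borel_measurable lebesgue \<and>
          (\<exists>\<alpha>>0. modular \<Phi> (\<lambda>x. \<alpha> *\<^sub>R \<omega> x) < \<infinity>)}"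

definition gauge_norm :: "(real \<Rightarrow> real) \<Rightarrow> form \<Rightarrow> real" where
  "gauge_norm \<Phi> \<omega> = Inf {K. K > 0 \<and> modular \<Phi> (\<lambda>x. \<omega> x /\<^sub>R K) \<le> 1}"

section \<open>Reduced cohomology\<close>

definition closed_forms :: "(real \<Rightarrow> real) \<Rightarrow> int \<Rightarrow> form set" where
  "closed_forms \<Phi>2 k = {\<omega> \<in> orlicz_forms \<Phi>2 k. weak_differential k \<omega> (\<lambda>x. 0)}"

definition exact_forms :: "(real \<Rightarrow> real) \<Rightarrow> (real \<Rightarrow> real) \<Rightarrow> int \<Rightarrow> form set" where
  "exact_forms \<Phi>1 \<Phi>2 k =
     {\<omega> \<in> orlicz_forms \<Phi>2 k. \<exists>\<beta> \<in> orlicz_forms \<Phi>1 (k - 1). weak_differential (k - 1) \<beta> \<omega>}"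

definition exact_closure :: "(real \<Rightarrow> real) \<Rightarrow> (real \<Rightarrow> real) \<Rightarrow> int \<Rightarrow> form set" where
  "exact_closure \<Phi>1 \<Phi>2 k =
     {\<omega> \<in> orlicz_forms \<Phi>2 k.
        \<forall>\<epsilon>>0. \<exists>\<eta> \<in> exact_forms \<Phi>1 \<Phi>2 k. gauge_norm \<Phi>2 (\<lambda>x. \<omega> x - \<eta> x) < \<epsilon>}"

definition cohomologous ::
    "(real \<Rightarrow> real) \<Rightarrow> (real \<Rightarrow> real) \<Rightarrow> int \<Rightarrow> (form \<times> form) set" where
  "cohomologous \<Phi>1 \<Phi>2 k =
     {(\<omega>, \<eta>). \<omega> \<in> closed_forms \<Phi>2 k \<and> \<eta> \<in> closed_forms \<Phi>2 k \<and>
               (\<lambda>x. \<omega> x - \<eta> x) \<in> exact_closure \<Phi>1 \<Phi>2 k}"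

definition reduced_cohomology ::
    "(real \<Rightarrow> real) \<Rightarrow> (real \<Rightarrow> real) \<Rightarrow> int \<Rightarrow> form set set" where
  "reduced_cohomology \<Phi>1 \<Phi>2 k = closed_forms \<Phi>2 k // cohomologous \<Phi>1 \<Phi>2 k"

definition zero_cohomology_class :: "(real \<Rightarrow> real) \<Rightarrow> (real \<Rightarrow> real) \<Rightarrow> int \<Rightarrow> form set" where
  "zero_cohomology_class \<Phi>1 \<Phi>2 k = cohomologous \<Phi>1 \<Phi>2 k `` {\<lambda>x. 0}"

end

theory Submission imports Defs begin

text \<open>
  On the line every locally integrable form \<open>\<omega> = f dx\<close> is closed, so it has to be shown that
  each such form in the Orlicz space of \<open>\<Phi>2\<close> is a limit of exact ones.
  A function \<open>e\<close> that is integrable, vanishes outside a bounded interval and has integral 0 has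
  a bounded primitive that vanishes outside the same interval; this primitive belongs to
  every Orlicz space of an N-function, so \<open>e dx\<close> is exact
  (\<open>exact_of_compact_support_integral_zero\<close>).

  To approximate \<open>f\<close> by such functions, cut it off outside a large interval \<open>[-N, N]\<close> and
  let \<open>A\<close> be the integral of what remains. Spread the surplus evenly: subtract the constant
  \<open>A / M\<close> on an interval of length \<open>M\<close> next to \<open>[-N, N]\<close>. The result has integral 0, and both
  changes are cheap. The cut-off tail has small modular by dominated convergence, at any
  scale, since by the doubling condition the modular of every multiple of \<open>f\<close> is finite
  (\<open>Delta2_dilation\<close>, \<open>nn_integral_tail_small\<close>). The correction has modular
  \<open>M * \<Phi>2 (a / M)\<close>, where \<open>a\<close> is \<open>A\<close> up to a scale that depends on the required precision, and
  this tends to 0 as \<open>M\<close> grows, because \<open>\<Phi>2 x / x\<close> tends to 0 at the origin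
  (\<open>N_function_spread\<close>). The correction does not tend to 0 in the space of integrable functions:
  it is the superlinearity of N-functions at the origin that removes the obstruction \<open>A\<close>.

  The primitive is in general only absolutely continuous, so its weak differential is computed
  by exchanging two integrals (\<open>integral_primitive_by_parts\<close>).
\<close>

section \<open>Growth of N-functions\<close>

lemma N_function_measurable:
  assumes "N_function \<Phi>"
  shows "\<Phi> \<in> borel_measurable borel"
  using assms convex_on_continuous[of UNIV \<Phi>]
  by (auto simp: N_function_def intro!: borel_measurable_continuous_onI)

lemma N_function_mono:
  assumes "N_function \<Phi>" "0 \<le> x" "x \<le> y"
  shows "\<Phi> x \<le> \<Phi> y"
proof (cases "y = 0")
  case False
  have y: "y > 0" using assms False by linarith
  have "\<Phi> ((1 - x/y) *\<^sub>R 0 + (x/y) *\<^sub>R y) \<le> (1 - x/y) * \<Phi> 0 + (x/y) * \<Phi> y"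
    using assms y by (intro convex_onD[where A=UNIV]) (auto simp: N_function_def)
  also have "\<dots> = (x/y) * \<Phi> y" using assms(1) by (simp add: N_function_def)
  also have "\<dots> \<le> 1 * \<Phi> y"
    using assms y by (intro mult_right_mono) (auto simp: N_function_def)
  finally show ?thesis using y by simp
qed (use assms in simp)

text \<open>
  A substitute for the triangle inequality that costs only a factor 2 inside: the sum is at
  most twice the larger summand.
\<close>

lemma N_function_add_le:
  assumes "N_function \<Phi>" "0 \<le> x" "0 \<le> y"
  shows "\<Phi> (x + y) \<le> \<Phi> (2 * x) + \<Phi> (2 * y)"
proof -
  have "\<Phi> (x + y) \<le> \<Phi> (max (2 * x) (2 * y))"
    using assms by (intro N_function_mono[OF assms(1)]) auto
  also have "\<dots> \<le> \<Phi> (2 * x) + \<Phi> (2 * y)"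
    using assms(1) by (auto simp: N_function_def max_def)
  finally show ?thesis .
qed

text \<open>
  Iterating the doubling condition controls every dilation, which makes the modular of a
  form finite at all scales as soon as it is finite at one.
\<close>

lemma Delta2_dilation:
  assumes "N_function \<Phi>" "Delta2 \<Phi>"
  obtains C where "C \<ge> 0" "\<And>x. x \<ge> 0 \<Longrightarrow> \<Phi> (c * x) \<le> C * \<Phi> x"
proof -
  obtain K where K: "K > 2" "\<And>x. x \<ge> 0 \<Longrightarrow> \<Phi> (2 * x) \<le> K * \<Phi> x"
    using assms(2) unfolding Delta2_def by auto
  have *: "\<Phi> (2^n * x) \<le> K^n * \<Phi> x" if "x \<ge> 0" for n x
  proof (induction n)
    case (Suc n)
    have "\<Phi> (2 * (2^n * x)) \<le> K * \<Phi> (2^n * x)" using K(2) that by simp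
    also have "\<dots> \<le> K * (K^n * \<Phi> x)" using Suc K(1) by (intro mult_left_mono) auto
    finally show ?case by (simp add: mult.assoc)
  qed simp
  obtain n where n: "\<bar>c\<bar> < 2^n" using real_arch_pow[of 2 "\<bar>c\<bar>"] by auto
  have "\<Phi> (c * x) \<le> K^n * \<Phi> x" if "x \<ge> 0" for x
  proof -
    have "\<Phi> (c * x) = \<Phi> (\<bar>c\<bar> * x)" using assms(1) by (auto simp: abs_if N_function_def)
    also have "\<dots> \<le> \<Phi> (2^n * x)"
      using n that by (intro N_function_mono[OF assms(1)] mult_right_mono) auto
    also have "\<dots> \<le> K^n * \<Phi> x" using * that by simp
    finally show ?thesis .
  qed
  moreover have "K^n \<ge> 0" using K(1) by simp
  ultimately show ?thesis using that by blast
qed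

text \<open>
  The mass \<open>a\<close>, spread evenly over a long interval, has arbitrarily small modular:
  \<open>M * \<Phi> (a / M) = a * (\<Phi> y / y)\<close> with \<open>y = a / M\<close> tending to 0.
\<close>

lemma N_function_spread:
  assumes "N_function \<Phi>" "\<delta> > 0"
  obtains M where "M > 0" "M * \<Phi> (a / M) \<le> \<delta>"
proof (cases "a = 0")
  case True
  have "\<Phi> 0 = 0" using assms by (simp add: N_function_def)
  then show ?thesis using that[of 1] True assms(2) by simp
next
  case False
  have "((\<lambda>x. \<Phi> x / x) \<longlongrightarrow> 0) (at 0)" using assms by (simp add: N_function_def)
  moreover have "LIM M at_top. a / M :> at 0"
    unfolding filterlim_at using False
    by (auto intro!: tendsto_divide_0[OF tendsto_const] filterlim_ident filterlim_at_top_imp_at_infinity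
       eventually_mono[OF eventually_gt_at_top[of "0::real"]])
  ultimately have "((\<lambda>M. \<Phi> (a/M) / (a/M)) \<longlongrightarrow> 0) at_top" by (rule filterlim_compose)
  then have "((\<lambda>M. a * (\<Phi> (a/M) / (a/M))) \<longlongrightarrow> a * 0) at_top" by (intro tendsto_intros)
  then have "\<forall>\<^sub>F M in at_top. a * (\<Phi> (a/M) / (a/M)) < \<delta>"
    using assms(2) by (auto dest: order_tendstoD(2)[where a=\<delta>])
  then have "\<forall>\<^sub>F M in at_top. a * (\<Phi> (a/M) / (a/M)) < \<delta> \<and> M > (0::real)"
    using eventually_gt_at_top[of "0::real"] by eventually_elim auto
  then obtain M where "M > 0" "a * (\<Phi> (a/M) / (a/M)) < \<delta>"
    by (auto simp: eventually_at_top_linorder)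
  then show ?thesis using False that[of M] by (simp add: mult.commute)
qed

section \<open>Modulars and Orlicz forms\<close>

lemma form_component_measurable:
  fixes e :: "real \<Rightarrow> real"
  assumes [measurable]: "e \<in> borel_measurable M"
  shows "(\<lambda>x. (0::real, e x)) \<in> borel_measurable M" "(\<lambda>x. (e x, 0::real)) \<in> borel_measurable M"
  by (auto intro!: borel_measurable_Pair)

lemma form_coefficient_measurable:
  fixes \<omega> :: form
  assumes "\<omega> \<in> borel_measurable M"
  shows "(\<lambda>x. snd (\<omega> x)) \<in> borel_measurable M"
  by (rule measurable_compose[OF assms]) (auto intro!: borel_measurable_continuous_onI continuous_intros)

lemma modular_mono:
  assumes "N_function \<Phi>" "\<And>x. norm (a x) \<le> norm (b x)"
  shows "modular \<Phi> a \<le> modular \<Phi> b"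
  unfolding modular_def
  by (intro nn_integral_mono ennreal_leI N_function_mono[OF assms(1)] assms(2)) simp

lemma modular_add_le:
  assumes \<Phi>: "N_function \<Phi>"
    and [measurable]: "a \<in> borel_measurable lebesgue" "b \<in> borel_measurable lebesgue"
  shows "modular \<Phi> (\<lambda>x. a x + b x) \<le> modular \<Phi> (\<lambda>x. 2 *\<^sub>R a x) + modular \<Phi> (\<lambda>x. 2 *\<^sub>R b x)"
proof -
  note [measurable] = N_function_measurable[OF \<Phi>]
  have pw: "ennreal (\<Phi> (norm (a x + b x)))
      \<le> ennreal (\<Phi> (norm (2 *\<^sub>R a x))) + ennreal (\<Phi> (norm (2 *\<^sub>R b x)))" for x
  proof -
    have "\<Phi> (norm (a x + b x)) \<le> \<Phi> (norm (a x) + norm (b x))"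
      by (intro N_function_mono[OF \<Phi>] norm_triangle_ineq) auto
    also have "\<dots> \<le> \<Phi> (norm (2 *\<^sub>R a x)) + \<Phi> (norm (2 *\<^sub>R b x))"
      using N_function_add_le[OF \<Phi>] by simp
    finally show ?thesis
      using \<Phi> by (simp add: N_function_def ennreal_leI flip: ennreal_plus)
  qed
  have "modular \<Phi> (\<lambda>x. a x + b x)
      \<le> (\<integral>\<^sup>+x. ennreal (\<Phi> (norm (2 *\<^sub>R a x))) + ennreal (\<Phi> (norm (2 *\<^sub>R b x))) \<partial>lebesgue)"
    unfolding modular_def by (intro nn_integral_mono pw)
  also have "\<dots> = modular \<Phi> (\<lambda>x. 2 *\<^sub>R a x) + modular \<Phi> (\<lambda>x. 2 *\<^sub>R b x)"
    unfolding modular_def by (intro nn_integral_add) measurable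
  finally show ?thesis .
qed

lemma orlicz_forms_diff:
  assumes \<Phi>: "N_function \<Phi>" and "a \<in> orlicz_forms \<Phi> k" "b \<in> orlicz_forms \<Phi> k"
  shows "(\<lambda>x. a x - b x) \<in> orlicz_forms \<Phi> k"
proof -
  have [measurable]: "a \<in> borel_measurable lebesgue" "b \<in> borel_measurable lebesgue"
    using assms by (auto simp: orlicz_forms_def)
  obtain \<alpha> where \<alpha>: "\<alpha> > 0" "modular \<Phi> (\<lambda>x. \<alpha> *\<^sub>R a x) < \<infinity>"
    using assms by (auto simp: orlicz_forms_def)
  obtain \<beta> where \<beta>: "\<beta> > 0" "modular \<Phi> (\<lambda>x. \<beta> *\<^sub>R b x) < \<infinity>"
    using assms by (auto simp: orlicz_forms_def)
  define \<gamma> where "\<gamma> = min \<alpha> \<beta> / 2"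
  have \<gamma>: "\<gamma> > 0" "2 * \<gamma> \<le> \<alpha>" "2 * \<gamma> \<le> \<beta>" using \<alpha> \<beta> by (auto simp: \<gamma>_def)
  have "modular \<Phi> (\<lambda>x. \<gamma> *\<^sub>R (a x - b x)) = modular \<Phi> (\<lambda>x. \<gamma> *\<^sub>R a x + (- \<gamma>) *\<^sub>R b x)"
    by (simp add: algebra_simps)
  also have "\<dots> \<le> modular \<Phi> (\<lambda>x. 2 *\<^sub>R \<gamma> *\<^sub>R a x) + modular \<Phi> (\<lambda>x. 2 *\<^sub>R (- \<gamma>) *\<^sub>R b x)"
    by (rule modular_add_le[OF \<Phi>]) measurable
  also have "\<dots> \<le> modular \<Phi> (\<lambda>x. \<alpha> *\<^sub>R a x) + modular \<Phi> (\<lambda>x. \<beta> *\<^sub>R b x)"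
    using \<gamma> \<alpha> \<beta> by (intro add_mono modular_mono[OF \<Phi>]) (auto simp flip: mult.assoc intro!: mult_right_mono)
  also have "\<dots> < \<infinity>" using \<alpha> \<beta> by simp
  finally show ?thesis
    using assms(2,3) \<gamma>(1) by (auto simp: orlicz_forms_def form_of_degree_def)
qed

section \<open>Weak differentials of primitives\<close>

text \<open>
  Integration by parts for the primitive of a function that is merely integrable. Both sides
  are the double integral of \<open>e t * v' x\<close> over the half plane \<open>t \<le> x\<close>: integrating in \<open>t\<close> first
  produces the primitive, and integrating in \<open>x\<close> first produces \<open>- v t\<close>, as \<open>v\<close> vanishes far to
  the right.
\<close>

lemma integral_primitive_by_parts:
  fixes e v v' :: "real \<Rightarrow> real"
  assumes e: "integrable lborel e"
    and v: "\<And>x. (v has_real_derivative v' x) (at x)"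
    and v': "continuous_on UNIV v'"
    and supp: "\<And>x. \<bar>x\<bar> \<ge> R \<Longrightarrow> v x = 0" "\<And>x. \<bar>x\<bar> \<ge> R \<Longrightarrow> v' x = 0"
  shows "(\<integral>x. (\<integral>t. indicator {..x} t * e t \<partial>lborel) * v' x \<partial>lborel)
           = - (\<integral>t. e t * v t \<partial>lborel)"
proof -
  have [measurable]: "v' \<in> borel_measurable borel" "e \<in> borel_measurable borel"
    using v' e by (auto intro: borel_measurable_continuous_onI)
  have "integrable lborel (\<lambda>x. indicator {-R..R} x *\<^sub>R v' x)"
    by (rule borel_integrable_compact) (auto intro: continuous_on_subset[OF v'])
  also have "(\<lambda>x. indicator {-R..R} x *\<^sub>R v' x) = v'"
  proof
    show "indicator {-R..R} x *\<^sub>R v' x = v' x" for x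
      using supp(2)[of x] by (cases "\<bar>x\<bar> \<ge> R") (auto simp: indicator_def)
  qed
  finally have v'int: "integrable lborel v'" .
  define f where "f t x = (if t \<le> x then e t * v' x else 0)" for t x
  have [measurable]: "case_prod f \<in> borel_measurable (lborel \<Otimes>\<^sub>M lborel)"
    unfolding f_def by measurable
  have "integrable (lborel \<Otimes>\<^sub>M lborel) (\<lambda>(t,x). e t * v' x)"
    by (rule lborel_pair.Fubini_integrable)
       (auto simp: abs_mult intro!: integrable_mult_left integrable_mult_right integrable_abs e v'int)
  then have "integrable (lborel \<Otimes>\<^sub>M lborel) (case_prod f)"
    by (rule Bochner_Integration.integrable_bound) (auto simp: f_def)
  from lborel_pair.Fubini_integral[OF this]
  have "(\<integral>x. (\<integral>t. f t x \<partial>lborel) \<partial>lborel) = (\<integral>t. (\<integral>x. f t x \<partial>lborel) \<partial>lborel)" .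
  moreover have "(\<integral>t. f t x \<partial>lborel) = (\<integral>t. indicator {..x} t * e t \<partial>lborel) * v' x" for x
    unfolding integral_mult_left_zero[symmetric] f_def
    by (intro Bochner_Integration.integral_cong) (auto simp: indicator_def)
  moreover have "(\<integral>x. f t x \<partial>lborel) = - (e t * v t)" for t
  proof -
    define b where "b = max t R"
    have "(\<integral>x. f t x \<partial>lborel) = (\<integral>x. e t * (indicator {t..b} x *\<^sub>R v' x) \<partial>lborel)"
      by (intro Bochner_Integration.integral_cong) (auto simp: f_def b_def indicator_def supp(2))
    also have "\<dots> = e t * (\<integral>x. indicator {t..b} x *\<^sub>R v' x \<partial>lborel)" by simp
    also have "(\<integral>x. indicator {t..b} x *\<^sub>R v' x \<partial>lborel) = v b - v t"
      using v v' by (intro integral_FTC_atLeastAtMost)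
        (auto simp: b_def intro: continuous_on_subset has_field_derivative_at_within
          simp flip: has_real_derivative_iff_has_vector_derivative)
    also have "v b = 0" by (rule supp(1)) (simp add: b_def)
    finally show ?thesis by simp
  qed
  ultimately show ?thesis by simp
qed

text \<open>
  A test form of degree 0 is a test function. Both it and its derivative vanish off its support,
  hence outside \<open>U\<close> and outside a bounded interval; this lets integrals over \<open>U\<close> be replaced by
  integrals over the line.
\<close>

lemma test_function_cases:
  assumes "test_form U 0 u"
  obtains v R where "u = (\<lambda>x. (v x, 0))" "\<And>x. (v has_real_derivative deriv v x) (at x)"
    "continuous_on UNIV (deriv v)" "\<And>x. x \<notin> U \<Longrightarrow> v x = 0" "\<And>x. x \<notin> U \<Longrightarrow> deriv v x = 0"
    "\<And>x. \<bar>x\<bar> \<ge> R \<Longrightarrow> v x = 0" "\<And>x. \<bar>x\<bar> \<ge> R \<Longrightarrow> deriv v x = 0"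
proof -
  define v where "v = (\<lambda>x. fst (u x))"
  define S where "S = closure {x. u x \<noteq> 0}"
  have u: "u = (\<lambda>x. (v x, 0))"
    using assms by (auto simp: test_form_def form_of_degree_def v_def fun_eq_iff prod_eq_iff)
  have sm: "(deriv ^^ m) v differentiable_on UNIV" for m
    using assms by (auto simp: test_form_def smooth_form_def v_def)
  have d: "(v has_real_derivative deriv v x) (at x)" for x
    using sm[of 0] by (auto simp: differentiable_on_def real_differentiable_def DERIV_deriv_iff_real_differentiable)
  have c: "continuous_on UNIV (deriv v)"
    using sm[of 1] by (auto intro: differentiable_imp_continuous_on)
  have z: "v x = 0" if "x \<notin> S" for x
  proof -
    have "u x = 0" using that closure_subset[of "{x. u x \<noteq> 0}"] unfolding S_def by blast
    then show ?thesis by (simp add: v_def)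
  qed
  have z': "deriv v x = 0" if "x \<notin> S" for x
  proof -
    have "((\<lambda>x. 0) has_real_derivative deriv v x) (at x)"
      by (rule has_field_derivative_transform_within_open[OF d, of "- S"])
         (use that z in \<open>auto simp: S_def\<close>)
    then show ?thesis using DERIV_unique DERIV_const by blast
  qed
  have S: "compact S" "S \<subseteq> U" using assms by (auto simp: test_form_def S_def)
  then obtain B where B: "\<And>x. x \<in> S \<Longrightarrow> \<bar>x\<bar> \<le> B"
    using compact_imp_bounded[of S] by (auto simp: bounded_iff)
  have out: "x \<notin> S" if "\<bar>x\<bar> \<ge> B + 1" for x using B[of x] that by auto
  show ?thesis
    by (rule that[OF u d c, of "B + 1"]) (use S z z' out in auto)
qed

lemma form_locally_integrable:
  fixes a :: "real \<Rightarrow> real"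
  assumes "integrable lborel a"
  shows "locally_integrable_form (\<lambda>x. (a x, 0))" "locally_integrable_form (\<lambda>x. (0, a x))"
proof -
  have a: "integrable lebesgue a" using assms by (simp add: integrable_completion)
  have "integrable lebesgue (\<lambda>x. (a x, 0::real))" "integrable lebesgue (\<lambda>x. (0::real, a x))"
    by (auto intro!: integrable_bounded_linear[OF _ a] bounded_linear_Pair
        bounded_linear_zero bounded_linear_ident)
  then show "locally_integrable_form (\<lambda>x. (a x, 0))" "locally_integrable_form (\<lambda>x. (0, a x))"
    unfolding locally_integrable_form_def set_integrable_def
    by (auto simp del: scaleR_Pair intro!: integrable_mult_indicator fmeasurableD lmeasurable_compact)
qed

lemma weak_differential_primitive:
  fixes e :: "real \<Rightarrow> real"
  defines "b \<equiv> (\<lambda>x. \<integral>t. indicator {..x} t * e t \<partial>lborel)"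
  assumes e: "integrable lborel e" and b: "integrable lborel b"
  shows "weak_differential 0 (\<lambda>x. (b x, 0)) (\<lambda>x. (0, e x))"
  unfolding weak_differential_def
proof (intro conjI allI impI)
  fix U u assume A: "open U \<and> connected U \<and> U \<noteq> {} \<and> test_form U (1 - 0 - 1) u"
  then have "test_form U 0 u" by simp
  then obtain v R where v: "u = (\<lambda>x. (v x, 0))" "\<And>x. (v has_real_derivative deriv v x) (at x)"
    "continuous_on UNIV (deriv v)" "\<And>x. x \<notin> U \<Longrightarrow> v x = 0" "\<And>x. x \<notin> U \<Longrightarrow> deriv v x = 0"
    "\<And>x. \<bar>x\<bar> \<ge> R \<Longrightarrow> v x = 0" "\<And>x. \<bar>x\<bar> \<ge> R \<Longrightarrow> deriv v x = 0"
    by (rule test_function_cases) blast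
  have [measurable]: "v \<in> borel_measurable borel" "deriv v \<in> borel_measurable borel"
      "e \<in> borel_measurable borel" "b \<in> borel_measurable borel"
    using v(2,3) e b by (auto intro!: borel_measurable_continuous_onI DERIV_continuous_on
        intro: DERIV_subset)
  have "form_integral U (wedge (\<lambda>x. (b x, 0)) (ext_deriv u)) = (\<integral>x. b x * deriv v x \<partial>lebesgue)"
    unfolding form_integral_def wedge_def ext_deriv_def v(1) set_lebesgue_integral_def
    by (intro Bochner_Integration.integral_cong) (auto simp: indicator_def v(5))
  also have "\<dots> = (\<integral>x. b x * deriv v x \<partial>lborel)" by (simp add: integral_completion)
  also have "\<dots> = - (\<integral>t. e t * v t \<partial>lborel)"
    unfolding b_def by (rule integral_primitive_by_parts[OF e v(2,3,6,7)])
  also have "(\<integral>t. e t * v t \<partial>lborel) = (\<integral>t. e t * v t \<partial>lebesgue)" by (simp add: integral_completion)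
  also have "\<dots> = form_integral U (wedge (\<lambda>x. (0, e x)) u)"
    unfolding form_integral_def wedge_def v(1) set_lebesgue_integral_def
    by (intro Bochner_Integration.integral_cong) (auto simp: indicator_def v(4))
  finally show "form_integral U (wedge (\<lambda>x. (b x, 0)) (ext_deriv u)) =
      (-1) powi (0 + 1) * form_integral U (wedge (\<lambda>x. (0, e x)) u)" by simp
qed (use form_locally_integrable e b in \<open>auto simp: form_of_degree_def\<close>)

section \<open>Exact forms and approximation by them\<close>

text \<open>
  The primitive vanishes to the left of the support of \<open>e\<close>, and to the right of it because the
  total integral is 0. Being also bounded, by the \<open>L\<^sup>1\<close> norm of \<open>e\<close>, it has finite modular.
\<close>

lemma exact_of_compact_support_integral_zero:
  fixes e :: "real \<Rightarrow> real"
  assumes \<Phi>: "N_function \<Phi>"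
    and e: "integrable lborel e" and supp: "\<And>x. \<bar>x\<bar> > R \<Longrightarrow> e x = 0"
    and zero: "(\<integral>x. e x \<partial>lborel) = 0"
  shows "\<exists>\<beta> \<in> orlicz_forms \<Phi> 0. weak_differential 0 \<beta> (\<lambda>x. (0, e x))"
proof -
  have [measurable]: "e \<in> borel_measurable borel" using e by auto
  define b where "b = (\<lambda>x. \<integral>t. indicator {..x} t * e t \<partial>lborel)"
  define C where "C = (\<integral>t. \<bar>e t\<bar> \<partial>lborel)"
  have C: "C \<ge> 0" by (simp add: C_def)
  have "b = (\<lambda>x. \<integral>t. (if t \<le> x then e t else 0) \<partial>lborel)"
    unfolding b_def by (intro ext Bochner_Integration.integral_cong) (auto simp: indicator_def)
  then have [measurable]: "b \<in> borel_measurable borel" by simp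
  have bound: "\<bar>b x\<bar> \<le> C" for x
  proof -
    have "\<bar>b x\<bar> \<le> (\<integral>t. \<bar>indicator {..x} t * e t\<bar> \<partial>lborel)"
      unfolding b_def by (rule integral_abs_bound)
    also have "\<dots> \<le> C" unfolding C_def
      using integrable_mult_indicator[OF _ e, of "{..x}"]
      by (intro integral_mono integrable_abs e) (auto simp: abs_mult indicator_def)
    finally show ?thesis .
  qed
  have left: "b x = 0" if "x < - R" for x
    unfolding b_def using that supp
    by (intro integral_eq_zero_AE) (auto simp: indicator_def)
  have right: "b x = 0" if "x > R" for x
  proof -
    have "b x = (\<integral>t. e t \<partial>lborel)"
      unfolding b_def using that supp
      by (intro Bochner_Integration.integral_cong) (auto simp: indicator_def)
    then show ?thesis using zero by simp
  qed
  have dom: "\<bar>b x\<bar> \<le> C * indicator {-R..R} x" for x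
    using bound[of x] left[of x] right[of x] C by (cases "x \<in> {-R..R}") auto
  have "integrable lborel (\<lambda>x. C * indicator {-R..R} x)"
    by (intro integrable_mult_right integrable_real_indicator) (auto simp: emeasure_lborel_Icc_eq)
  then have bint: "integrable lborel b"
    by (rule Bochner_Integration.integrable_bound) (use dom C in \<open>auto simp: abs_mult\<close>)
  have "modular \<Phi> (\<lambda>x. 1 *\<^sub>R (b x, 0)) \<le> (\<integral>\<^sup>+x. ennreal (\<Phi> C) * indicator {-R..R} x \<partial>lebesgue)"
    unfolding modular_def
  proof (intro nn_integral_mono)
    fix x
    have "\<Phi> \<bar>b x\<bar> \<le> \<Phi> (C * indicator {-R..R} x)" by (intro N_function_mono[OF \<Phi>] dom) simp
    also have "\<dots> = \<Phi> C * indicator {-R..R} x"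
      using \<Phi> by (auto simp: indicator_def N_function_def)
    finally show "ennreal (\<Phi> (norm (1 *\<^sub>R (b x, 0::real)))) \<le> ennreal (\<Phi> C) * indicator {-R..R} x"
      by (auto simp: indicator_def ennreal_neg intro: ennreal_leI split: if_splits)
  qed
  also have "\<dots> < \<infinity>"
    by (simp add: nn_integral_cmult_indicator ennreal_mult_less_top emeasure_lborel_Icc_eq)
  finally have "modular \<Phi> (\<lambda>x. 1 *\<^sub>R (b x, 0)) < \<infinity>" .
  moreover have "(\<lambda>x. (b x, 0::real)) \<in> borel_measurable lebesgue"
    by (rule form_component_measurable(2), rule measurable_completion) measurable
  ultimately have "(\<lambda>x. (b x, 0)) \<in> orlicz_forms \<Phi> 0"
    unfolding orlicz_forms_def mem_Collect_eq
    by (intro conjI exI[of _ 1]) (auto simp: form_of_degree_def)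
  then show ?thesis
    using weak_differential_primitive[OF e bint[unfolded b_def]] unfolding b_def by blast
qed

lemma nn_integral_tail_small:
  fixes g :: "real \<Rightarrow> ennreal"
  assumes [measurable]: "g \<in> borel_measurable lborel"
    and fin: "(\<integral>\<^sup>+x. g x \<partial>lborel) < \<infinity>" and "(\<delta>::real) > 0"
  obtains N :: real where "N > 0" "(\<integral>\<^sup>+x. g x * indicator (- {-N..N}) x \<partial>lborel) \<le> ennreal \<delta>"
proof -
  have lim: "(\<lambda>n. \<integral>\<^sup>+x. g x * indicator (- {-real n..real n}) x \<partial>lborel)
      \<longlonglongrightarrow> nn_integral lborel (\<lambda>x::real. 0)"
  proof (rule nn_integral_dominated_convergence[where w = g])
    show "AE x in lborel. (\<lambda>n. g x * indicator (- {-real n..real n}) x) \<longlonglongrightarrow> 0"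
    proof (rule AE_I2)
      fix x :: real
      obtain n0 :: nat where "\<bar>x\<bar> \<le> real n0" using real_arch_simple by blast
      then have "g x * indicator (- {-real n..real n}) x = 0" if "n \<ge> n0" for n
        using that of_nat_mono[OF that, where ?'a=real] by (auto simp: indicator_def)
      then show "(\<lambda>n. g x * indicator (- {-real n..real n}) x) \<longlonglongrightarrow> 0"
        by (intro tendsto_eventually) (auto simp: eventually_sequentially)
    qed
  qed (use fin in \<open>auto simp: indicator_def\<close>)
  have "\<forall>\<^sub>F n in sequentially. (\<integral>\<^sup>+x. g x * indicator (- {-real n..real n}) x \<partial>lborel) < ennreal \<delta>"
    using order_tendstoD(2)[OF lim, of "ennreal \<delta>"] \<open>\<delta> > 0\<close> by simp
  then have "\<forall>\<^sub>F n in sequentially. n > 0 \<and> (\<integral>\<^sup>+x. g x * indicator (- {-real n..real n}) x \<partial>lborel) < ennreal \<delta>"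
    using eventually_gt_at_top[of "0::nat"] by eventually_elim auto
  then obtain n where "n > 0" "(\<integral>\<^sup>+x. g x * indicator (- {-real n..real n}) x \<partial>lborel) < ennreal \<delta>"
    by (auto simp: eventually_sequentially)
  then show ?thesis using that[of "real n"] by simp
qed

text \<open>
  The approximation step: cut \<open>f\<close> off outside \<open>[-N, N]\<close>, then subtract a low plateau on
  \<open>(N, N + M]\<close> that carries the same integral. Local integrability makes that integral finite.
\<close>

lemma locally_integrable_in_exact_closure:
  assumes \<Phi>1: "N_function \<Phi>1" and \<Phi>2: "N_function \<Phi>2" "Delta2 \<Phi>2"
    and \<omega>: "\<omega> \<in> orlicz_forms \<Phi>2 1" and loc: "locally_integrable_form \<omega>"
  shows "\<omega> \<in> exact_closure \<Phi>1 \<Phi>2 1"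
proof -
  note [measurable] = N_function_measurable[OF \<Phi>2(1)]
  have \<Phi>0: "\<Phi>2 0 = 0" "\<And>x. \<Phi>2 x \<ge> 0" using \<Phi>2(1) by (auto simp: N_function_def)
  define f where "f = (\<lambda>x. snd (\<omega> x))"
  have \<omega>f: "\<omega> = (\<lambda>x. (0, f x))"
    using \<omega> by (auto simp: orlicz_forms_def form_of_degree_def f_def fun_eq_iff prod_eq_iff)
  have \<omega>m: "\<omega> \<in> borel_measurable lebesgue" using \<omega> by (simp add: orlicz_forms_def)
  have fm: "f \<in> borel_measurable lebesgue"
    unfolding f_def by (rule form_coefficient_measurable[OF \<omega>m])
  \<comment> \<open>Pass to a Borel representative: the primitive is integrated by parts with Fubini's theorem
    on the product of two copies of \<open>lborel\<close>, which needs a Borel measurable integrand.\<close>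
  obtain w where w[measurable]: "w \<in> borel_measurable lborel" and fw: "AE x in lborel. f x = w x"
    using completion_ex_borel_measurable_real[OF fm] by auto
  obtain \<alpha> where \<alpha>: "\<alpha> > 0" "modular \<Phi>2 (\<lambda>x. \<alpha> *\<^sub>R \<omega> x) < \<infinity>"
    using \<omega> by (auto simp: orlicz_forms_def)
  have wfin: "(\<integral>\<^sup>+x. ennreal (\<Phi>2 (\<alpha> * \<bar>w x\<bar>)) \<partial>lborel) < \<infinity>"
  proof -
    have "(\<integral>\<^sup>+x. ennreal (\<Phi>2 (\<alpha> * \<bar>w x\<bar>)) \<partial>lborel) = (\<integral>\<^sup>+x. ennreal (\<Phi>2 (\<alpha> * \<bar>f x\<bar>)) \<partial>lborel)"
      by (intro nn_integral_cong_AE) (use fw in eventually_elim, simp)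
    also have "\<dots> = modular \<Phi>2 (\<lambda>x. \<alpha> *\<^sub>R \<omega> x)"
      using \<alpha>(1) by (simp add: modular_def \<omega>f nn_integral_completion abs_mult)
    finally show ?thesis using \<alpha>(2) by simp
  qed
  have "\<exists>\<eta> \<in> exact_forms \<Phi>1 \<Phi>2 1. gauge_norm \<Phi>2 (\<lambda>x. \<omega> x - \<eta> x) < \<epsilon>" if \<epsilon>: "\<epsilon> > 0" for \<epsilon>
  proof -
    \<comment> \<open>The gauge norm will be at most \<open>\<epsilon> / 2\<close>; dividing by \<open>\<epsilon> / 2\<close> and splitting the error into two
      summands contribute a factor \<open>2 / \<epsilon>\<close> and a factor 2.\<close>
    define c where "c = 4 / \<epsilon>"
    have c: "c > 0" using \<epsilon> by (simp add: c_def)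
    obtain C where C: "C \<ge> 0" "\<And>x. x \<ge> 0 \<Longrightarrow> \<Phi>2 (c / \<alpha> * x) \<le> C * \<Phi>2 x"
      using Delta2_dilation[OF \<Phi>2] by blast
    have "(\<integral>\<^sup>+x. ennreal (\<Phi>2 (c * \<bar>w x\<bar>)) \<partial>lborel)
        \<le> (\<integral>\<^sup>+x. ennreal C * ennreal (\<Phi>2 (\<alpha> * \<bar>w x\<bar>)) \<partial>lborel)"
    proof (intro nn_integral_mono)
      fix x
      show "ennreal (\<Phi>2 (c * \<bar>w x\<bar>)) \<le> ennreal C * ennreal (\<Phi>2 (\<alpha> * \<bar>w x\<bar>))"
        using C(2)[of "\<alpha> * \<bar>w x\<bar>"] C(1) \<alpha>(1) \<Phi>0
        by (simp add: ennreal_leI flip: ennreal_mult)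
    qed
    also have "\<dots> = ennreal C * (\<integral>\<^sup>+x. ennreal (\<Phi>2 (\<alpha> * \<bar>w x\<bar>)) \<partial>lborel)"
      by (intro nn_integral_cmult) measurable
    also have "\<dots> < \<infinity>" using wfin by (simp add: ennreal_mult_less_top)
    finally have cfin: "(\<integral>\<^sup>+x. ennreal (\<Phi>2 (c * \<bar>w x\<bar>)) \<partial>lborel) < \<infinity>" .
    obtain N where N: "N > 0"
      "(\<integral>\<^sup>+x. ennreal (\<Phi>2 (c * \<bar>w x\<bar>)) * indicator (- {-N..N}) x \<partial>lborel) \<le> ennreal (1/2)"
      by (rule nn_integral_tail_small[OF _ cfin, of "1/2"]) auto
    define A where "A = (\<integral>x. indicator {-N..N} x * w x \<partial>lborel)"
    obtain M where M: "M > 0" "M * \<Phi>2 (c * \<bar>A\<bar> / M) \<le> 1/2"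
      using N_function_spread[OF \<Phi>2(1), of "1/2" "c * \<bar>A\<bar>"] by auto
    define e where "e = (\<lambda>x. indicator {-N..N} x * w x - A / M * indicator {N<..N+M} x)"
    define \<eta> :: form where "\<eta> = (\<lambda>x. (0, e x))"

    have wint: "integrable lborel (\<lambda>x. indicator {-N..N} x * w x)"
    proof -
      have "integrable lebesgue (\<lambda>x. indicator {-N..N} x *\<^sub>R \<omega> x)"
        using loc by (auto simp: locally_integrable_form_def set_integrable_def)
      from integrable_bounded_linear[OF bounded_linear_snd this]
      have "integrable lebesgue (\<lambda>x. indicator {-N..N} x * f x)" by (simp add: f_def)
      also have "?this \<longleftrightarrow> integrable lebesgue (\<lambda>x. indicator {-N..N} x * w x)"
      proof (rule integrable_cong_AE)
        show "AE x in lebesgue. indicator {-N..N} x * f x = indicator {-N..N} x * w x"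
          by (rule AE_completion) (use fw in eventually_elim, simp)
        show "(\<lambda>x. indicator {-N..N} x * f x) \<in> borel_measurable lebesgue"
          by (intro borel_measurable_times fm measurable_completion) measurable
        show "(\<lambda>x. indicator {-N..N} x * w x) \<in> borel_measurable lebesgue"
          by (intro measurable_completion) measurable
      qed
      finally show ?thesis by (simp add: integrable_completion)
    qed
    have hint: "integrable lborel (\<lambda>x. A / M * indicator {N<..N+M} x)"
      using M by (auto simp: emeasure_lborel_Ioc)
    have eint: "integrable lborel e" unfolding e_def by (intro Bochner_Integration.integrable_diff wint hint)
    have [measurable]: "e \<in> borel_measurable borel" using eint by auto
    have "(\<integral>x. e x \<partial>lborel) = A - A / M * M"
      unfolding e_def using M by (subst Bochner_Integration.integral_diff[OF wint hint]) (simp add: A_def)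
    then have ezero: "(\<integral>x. e x \<partial>lborel) = 0" using M by simp
    have esupp: "e x = 0" if "\<bar>x\<bar> > N + M" for x
      using that N(1) M(1) by (auto simp: e_def indicator_def)
    obtain \<beta> where \<beta>: "\<beta> \<in> orlicz_forms \<Phi>1 0" "weak_differential 0 \<beta> \<eta>"
      using exact_of_compact_support_integral_zero[OF \<Phi>1 eint esupp ezero] unfolding \<eta>_def by blast

    have small: "modular \<Phi>2 (\<lambda>x. (\<omega> x - \<eta> x) /\<^sub>R (\<epsilon> / 2)) \<le> 1"
    proof -
      \<comment> \<open>The error is the sum of the tail \<open>p\<close> and the plateau \<open>q\<close>; each takes half of the
        admissible modular.\<close>
      have pw: "ennreal (\<Phi>2 (\<bar>w x - e x\<bar> / (\<epsilon> / 2)))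
          \<le> ennreal (\<Phi>2 (c * \<bar>w x\<bar>)) * indicator (- {-N..N}) x
             + ennreal (\<Phi>2 (c * \<bar>A\<bar> / M)) * indicator {N<..N+M} x" for x
      proof -
        define p where "p = \<bar>w x\<bar> * indicator (- {-N..N}) x"
        define q where "q = \<bar>A\<bar> / M * indicator {N<..N+M} x"
        have pq: "p \<ge> 0" "q \<ge> 0" using M by (auto simp: p_def q_def)
        have "\<bar>w x - e x\<bar> \<le> p + q"
          unfolding e_def p_def q_def using M(1) abs_triangle_ineq[of "w x" "A / M"]
          by (cases "x \<in> {-N..N}"; cases "x \<in> {N<..N+M}") (auto simp: abs_mult)
        then have "\<bar>w x - e x\<bar> / (\<epsilon> / 2) \<le> (p + q) / (\<epsilon> / 2)"
          using \<epsilon> by (intro divide_right_mono) auto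
        also have "\<dots> = c / 2 * p + c / 2 * q" by (simp add: c_def add_divide_distrib mult.commute)
        finally have "\<Phi>2 (\<bar>w x - e x\<bar> / (\<epsilon> / 2)) \<le> \<Phi>2 (c / 2 * p + c / 2 * q)"
          using \<epsilon> by (intro N_function_mono[OF \<Phi>2(1)]) auto
        also have "\<dots> \<le> \<Phi>2 (c * p) + \<Phi>2 (c * q)"
          using N_function_add_le[OF \<Phi>2(1), of "c / 2 * p" "c / 2 * q"] c pq by simp
        finally have "ennreal (\<Phi>2 (\<bar>w x - e x\<bar> / (\<epsilon> / 2))) \<le> ennreal (\<Phi>2 (c * p)) + ennreal (\<Phi>2 (c * q))"
          using \<Phi>0 by (simp add: ennreal_leI flip: ennreal_plus)
        also have "ennreal (\<Phi>2 (c * p)) = ennreal (\<Phi>2 (c * \<bar>w x\<bar>)) * indicator (- {-N..N}) x"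
          by (simp add: p_def indicator_def \<Phi>0)
        also have "ennreal (\<Phi>2 (c * q)) = ennreal (\<Phi>2 (c * \<bar>A\<bar> / M)) * indicator {N<..N+M} x"
          by (simp add: q_def indicator_def \<Phi>0)
        finally show ?thesis .
      qed
      have "norm ((\<omega> x - \<eta> x) /\<^sub>R (\<epsilon> / 2)) = \<bar>f x - e x\<bar> / (\<epsilon> / 2)" for x
        using \<epsilon> by (subst norm_scaleR) (simp add: \<omega>f \<eta>_def)
      then have "modular \<Phi>2 (\<lambda>x. (\<omega> x - \<eta> x) /\<^sub>R (\<epsilon> / 2))
          = (\<integral>\<^sup>+x. ennreal (\<Phi>2 (\<bar>f x - e x\<bar> / (\<epsilon> / 2))) \<partial>lborel)"
        by (simp only: modular_def nn_integral_completion)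
      also have "\<dots> = (\<integral>\<^sup>+x. ennreal (\<Phi>2 (\<bar>w x - e x\<bar> / (\<epsilon> / 2))) \<partial>lborel)"
        by (intro nn_integral_cong_AE) (use fw in eventually_elim, simp)
      also have "\<dots> \<le> (\<integral>\<^sup>+x. ennreal (\<Phi>2 (c * \<bar>w x\<bar>)) * indicator (- {-N..N}) x
             + ennreal (\<Phi>2 (c * \<bar>A\<bar> / M)) * indicator {N<..N+M} x \<partial>lborel)"
        by (intro nn_integral_mono pw)
      also have "\<dots> = (\<integral>\<^sup>+x. ennreal (\<Phi>2 (c * \<bar>w x\<bar>)) * indicator (- {-N..N}) x \<partial>lborel)
             + (\<integral>\<^sup>+x. ennreal (\<Phi>2 (c * \<bar>A\<bar> / M)) * indicator {N<..N+M} x \<partial>lborel)"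
        by (intro nn_integral_add) measurable
      also have "\<dots> \<le> ennreal (1/2) + ennreal (1/2)"
      proof (intro add_mono N(2))
        have "(\<integral>\<^sup>+x. ennreal (\<Phi>2 (c * \<bar>A\<bar> / M)) * indicator {N<..N+M} x \<partial>lborel)
            = ennreal (\<Phi>2 (c * \<bar>A\<bar> / M)) * ennreal M"
          using M(1) by (simp add: nn_integral_cmult_indicator)
        also have "\<dots> = ennreal (M * \<Phi>2 (c * \<bar>A\<bar> / M))"
          using \<Phi>0 M(1) by (simp add: mult.commute flip: ennreal_mult)
        also have "\<dots> \<le> ennreal (1/2)" by (intro ennreal_leI M(2))
        finally show "(\<integral>\<^sup>+x. ennreal (\<Phi>2 (c * \<bar>A\<bar> / M)) * indicator {N<..N+M} x \<partial>lborel)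
            \<le> ennreal (1/2)" .
      qed
      also have "\<dots> = 1" by (subst ennreal_plus[symmetric]) auto
      finally show ?thesis .
    qed

    have \<eta>m: "\<eta> \<in> borel_measurable lebesgue"
      unfolding \<eta>_def by (rule form_component_measurable(1), rule measurable_completion) measurable
    \<comment> \<open>The error is an Orlicz form, as its modular at scale \<open>\<epsilon> / 2\<close> is finite; hence so is \<open>\<eta>\<close>,
      the difference of \<open>\<omega>\<close> and the error.\<close>
    have "(\<lambda>x. \<omega> x - \<eta> x) \<in> orlicz_forms \<Phi>2 1"
      unfolding orlicz_forms_def mem_Collect_eq
    proof (intro conjI exI[of _ "inverse (\<epsilon> / 2)"])
      show "form_of_degree 1 (\<lambda>x. \<omega> x - \<eta> x)" by (simp add: form_of_degree_def \<omega>f \<eta>_def)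
      show "(\<lambda>x. \<omega> x - \<eta> x) \<in> borel_measurable lebesgue" using \<omega>m \<eta>m by (rule borel_measurable_diff)
      show "modular \<Phi>2 (\<lambda>x. inverse (\<epsilon> / 2) *\<^sub>R (\<omega> x - \<eta> x)) < \<infinity>"
        using small by (rule le_less_trans) simp
    qed (use \<epsilon> in simp)
    from orlicz_forms_diff[OF \<Phi>2(1) \<omega> this] have "\<eta> \<in> orlicz_forms \<Phi>2 1" by simp
    then have "\<eta> \<in> exact_forms \<Phi>1 \<Phi>2 1" using \<beta> by (auto simp: exact_forms_def)
    moreover have "gauge_norm \<Phi>2 (\<lambda>x. \<omega> x - \<eta> x) \<le> \<epsilon> / 2"
      unfolding gauge_norm_def using small \<epsilon> by (intro cInf_lower bdd_belowI[of _ 0]) auto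
    ultimately show ?thesis using \<epsilon> by (intro bexI[of _ \<eta>]) auto
  qed
  then show ?thesis using \<omega> by (simp add: exact_closure_def)
qed

section \<open>The reduced cohomology\<close>

text \<open>
  The test forms for the differential of a 1-form have degree \<open>- 1\<close>, so they are zero and the
  integral identity is trivial; what is left of closedness is local integrability.
\<close>

lemma closed_one_forms_eq:
  "closed_forms \<Phi> 1 = {\<omega> \<in> orlicz_forms \<Phi> 1. locally_integrable_form \<omega>}"
proof -
  have "weak_differential 1 \<omega> (\<lambda>x. 0)" if "form_of_degree 1 \<omega>" "locally_integrable_form \<omega>" for \<omega>
  proof -
    have u0: "u = (\<lambda>x. 0)" if "test_form U (1 - 1 - 1) u" for U u
      using that by (auto simp: test_form_def form_of_degree_def fun_eq_iff prod_eq_iff)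
    show ?thesis
      using that unfolding weak_differential_def
      by (auto dest!: u0 simp: form_integral_def wedge_def ext_deriv_def form_of_degree_def
          locally_integrable_form_def set_integrable_def set_lebesgue_integral_def)
  qed
  then show ?thesis
    by (auto simp: closed_forms_def orlicz_forms_def weak_differential_def)
qed

lemma locally_integrable_form_diff:
  "locally_integrable_form \<omega> \<Longrightarrow> locally_integrable_form \<eta> \<Longrightarrow> locally_integrable_form (\<lambda>x. \<omega> x - \<eta> x)"
  by (auto simp: locally_integrable_form_def intro: set_integral_diff)

theorem proposition4p3:
  fixes \<Phi>1 \<Phi>2 :: "real \<Rightarrow> real"
  assumes "N_function \<Phi>1" and "N_function \<Phi>2" and "Delta2 \<Phi>2"
  shows "reduced_cohomology \<Phi>1 \<Phi>2 1 = {zero_cohomology_class \<Phi>1 \<Phi>2 1}"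
proof -
  have "(\<lambda>x. \<omega> x - \<eta> x) \<in> exact_closure \<Phi>1 \<Phi>2 1"
    if "\<omega> \<in> closed_forms \<Phi>2 1" "\<eta> \<in> closed_forms \<Phi>2 1" for \<omega> \<eta>
    using that unfolding closed_one_forms_eq
    by (auto intro: locally_integrable_in_exact_closure[OF assms] orlicz_forms_diff[OF assms(2)]
        locally_integrable_form_diff)
  \<comment> \<open>Hence all closed forms are cohomologous, and each class is the set of all of them.\<close>
  then have all: "cohomologous \<Phi>1 \<Phi>2 1 `` {\<omega>} = closed_forms \<Phi>2 1" if "\<omega> \<in> closed_forms \<Phi>2 1" for \<omega>
    using that by (auto simp: cohomologous_def)
  have "\<Phi>2 0 = 0" using assms(2) by (simp add: N_function_def)
  then have zero: "(\<lambda>x. 0) \<in> closed_forms \<Phi>2 1"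
    unfolding closed_one_forms_eq orlicz_forms_def
    by (auto simp: form_of_degree_def modular_def locally_integrable_form_def set_integrable_def
        intro: exI[of _ 1])
  have "reduced_cohomology \<Phi>1 \<Phi>2 1 = {closed_forms \<Phi>2 1}"
    unfolding reduced_cohomology_def quotient_def using all zero by auto
  then show ?thesis unfolding zero_cohomology_class_def all[OF zero] .
qed

end
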